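(* Consider the system $$\frac{dx}{dt}=y,\qquad \frac{dy}{dt}=yz+\frac{2\alpha_1-1}{t^2}x+\frac{\alpha_0}{t^2},$$ $$\frac{dz}{dt}=-\frac12 z^2-\frac4t x-4y-\frac2t z+\frac{(2\alpha_1-1)(2\alpha_1-3)}{2t^2}+\frac2t$$ with $(\alpha_0,\alpha_1)=\left(0,\tfrac32\right)$. It admits solutions of the form $$x=0,\qquad y=0,\qquad \frac{dz}{dt}=-\frac12z^2-\frac2t z+\frac2t .$$ By the change of variables $z=2\frac{d}{dt}\log Z$, the equation for $z$ becomes the second-order linear equation $$t\frac{d^2Z}{dt^2}+2\frac{dZ}{dt}-Z=0,$$ which is solved by $$Z(t)=\sum_{k=0}^{\infty}\frac{1}{(2)_k}\frac{t^k}{k!}.$$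
   Context: $(a)_k:=a(a+1)\cdots(a+k-1)$ with $(a)_0=1$. The function $z=2Z'/Z$ is considered where $Z\neq0$ and $t\neq0$. *)

theory Defs
  imports "HOL-Complex_Analysis.Complex_Analysis"
begin

text \<open>
  The independent variable \<open>t\<close> and the parameters \<open>\<alpha>0\<close>, \<open>\<alpha>1\<close> are complex. Solutions live on a set
  \<open>S\<close>, in all uses an open subset of the complex plane without \<open>0\<close>, so that no division by \<open>t = 0\<close>
  (which HOL would evaluate to \<open>0\<close>) occurs.
\<close>

definition solves_system ::
  "complex \<Rightarrow> complex \<Rightarrow> complex set \<Rightarrow>
   (complex \<Rightarrow> complex) \<Rightarrow> (complex \<Rightarrow> complex) \<Rightarrow> (complex \<Rightarrow> complex) \<Rightarrow> bool" where
  "solves_system \<alpha>0 \<alpha>1 S x y z \<longleftrightarrow>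
     (\<forall>t\<in>S.
        (x has_field_derivative y t) (at t) \<and>
        (y has_field_derivative
           (y t * z t + (2 * \<alpha>1 - 1) / t^2 * x t + \<alpha>0 / t^2)) (at t) \<and>
        (z has_field_derivative
           (- 1 / 2 * (z t)^2 - 4 / t * x t - 4 * y t - 2 / t * z t
            + (2 * \<alpha>1 - 1) * (2 * \<alpha>1 - 3) / (2 * t^2) + 2 / t)) (at t))"

definition solves_riccati :: "complex set \<Rightarrow> (complex \<Rightarrow> complex) \<Rightarrow> bool" where
  "solves_riccati S z \<longleftrightarrow>
     (\<forall>t\<in>S. (z has_field_derivative (- 1 / 2 * (z t)^2 - 2 / t * z t + 2 / t)) (at t))"

definition solves_linear :: "complex set \<Rightarrow> (complex \<Rightarrow> complex) \<Rightarrow> bool" where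
  "solves_linear S Z \<longleftrightarrow>
     Z holomorphic_on S \<and>
     (\<forall>t\<in>S. t * deriv (deriv Z) t + 2 * deriv Z t - Z t = 0)"

text \<open>
  \<open>d/dt log Z\<close> means \<open>Z'/Z\<close>, which involves no choice of a branch of the logarithm;
  by the lemma below it is the derivative of every holomorphic branch that exists.
\<close>

definition log_deriv :: "(complex \<Rightarrow> complex) \<Rightarrow> complex \<Rightarrow> complex" where
  "log_deriv Z t = deriv Z t / Z t"

lemma log_deriv_eq_deriv_branch:
  assumes "open S" "L holomorphic_on S" "\<And>s. s \<in> S \<Longrightarrow> exp (L s) = Z s" "t \<in> S"
  shows "log_deriv Z t = deriv L t"
proof -
  have "(L has_field_derivative deriv L t) (at t)"
    using assms by (auto intro: holomorphic_derivI)
  then have "((\<lambda>s. exp (L s)) has_field_derivative exp (L t) * deriv L t) (at t)"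
    by (rule DERIV_chain2[OF DERIV_exp])
  then have "(Z has_field_derivative exp (L t) * deriv L t) (at t)"
    using has_field_derivative_transform_within_open assms(1,3,4) by blast
  then have "deriv Z t = Z t * deriv L t"
    using DERIV_imp_deriv assms(3,4) by metis
  then show ?thesis
    using assms(3)[OF assms(4)] exp_not_eq_zero[of "L t"] by (simp add: log_deriv_def)
qed

definition Z_series :: "complex \<Rightarrow> complex" where
  "Z_series t = (\<Sum>k. 1 / pochhammer 2 k * (t ^ k / fact k))"

end

theory Submission
  imports Defs
begin

text \<open>
  With \<open>x = y = 0\<close> the first two equations hold trivially because \<open>\<alpha>0 = 0\<close>, and
  \<open>\<alpha>1 = 3/2\<close> annihilates the factor \<open>2 \<alpha>1 - 3\<close>; what is left of the third equation is a
  Riccati equation for \<open>z\<close>. For \<open>z = 2 Z'/Z\<close> the quotient rule gives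
  \<open>z' = 2 Z''/Z - z^2 / 2\<close>, so the quadratic term of the Riccati equation cancels and
  multiplication by \<open>t Z / 2\<close> turns the remainder into \<open>t Z'' + 2 Z' - Z = 0\<close>, with every step
  reversible where \<open>t\<close> and \<open>Z\<close> do not vanish (\<open>riccati_at_iff_linear_at\<close>).

  A power series with coefficients \<open>c\<close> solves the linear equation exactly if
  \<open>(k + 1) (k + 2) c (k + 1) = c k\<close>. The coefficients \<open>1 / ((2)\<^sub>k k!)\<close> satisfy this
  recursion and are dominated by those of the exponential series, so the series is an entire
  solution (\<open>Z_series_ode\<close>). Its value at \<open>0\<close> is \<open>1\<close>, so by continuity the set where
  \<open>t\<close> and \<open>Z\<close> are both nonzero is not empty; on this open set the two equivalences
  carry the series to a solution of the original system.
\<close>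

lemma system_zero_iff_riccati:
  "solves_system 0 (3/2) S (\<lambda>_. 0) (\<lambda>_. 0) z \<longleftrightarrow> solves_riccati S z"
  by (simp add: solves_system_def solves_riccati_def)

lemma log_deriv_has_field_derivative:
  assumes "open S" "Z holomorphic_on S" "t \<in> S" "Z t \<noteq> 0"
  shows "(log_deriv Z has_field_derivative deriv (deriv Z) t / Z t - (log_deriv Z t)^2) (at t)"
proof -
  have d1: "(Z has_field_derivative deriv Z t) (at t)"
    using assms by (auto intro: holomorphic_derivI)
  have d2: "(deriv Z has_field_derivative deriv (deriv Z) t) (at t)"
    using assms by (auto intro: holomorphic_derivI holomorphic_deriv)
  have "((\<lambda>s. deriv Z s / Z s) has_field_derivative
      (deriv (deriv Z) t * Z t - deriv Z t * deriv Z t) / (Z t * Z t)) (at t)"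
    by (rule DERIV_divide[OF d2 d1 assms(4)])
  moreover have "(deriv (deriv Z) t * Z t - deriv Z t * deriv Z t) / (Z t * Z t)
      = deriv (deriv Z) t / Z t - (log_deriv Z t)^2"
    using assms(4) by (simp add: log_deriv_def field_simps power2_eq_square)
  moreover have "(\<lambda>s. deriv Z s / Z s) = log_deriv Z"
    by (simp add: log_deriv_def fun_eq_iff)
  ultimately show ?thesis by simp
qed

text \<open>
  The equivalence holds at each point separately: \<open>z\<close> has only one derivative, and it is
  already known from the quotient rule, so the Riccati equation at \<open>t\<close> is an algebraic
  relation between \<open>Z\<close>, \<open>Z'\<close> and \<open>Z''\<close> at \<open>t\<close>.
\<close>

lemma riccati_at_iff_linear_at:
  assumes "open S" "Z holomorphic_on S" "t \<in> S" "t \<noteq> 0" "Z t \<noteq> 0"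
    and z: "\<And>s. s \<in> S \<Longrightarrow> z s = 2 * log_deriv Z s"
  shows "(z has_field_derivative (- 1 / 2 * (z t)^2 - 2 / t * z t + 2 / t)) (at t) \<longleftrightarrow>
         t * deriv (deriv Z) t + 2 * deriv Z t - Z t = 0"
    (is "(z has_field_derivative ?r) _ \<longleftrightarrow> ?lin")
proof -
  let ?d = "2 * (deriv (deriv Z) t / Z t - (log_deriv Z t)^2)"
  have "((\<lambda>s. 2 * log_deriv Z s) has_field_derivative ?d) (at t)"
    by (rule DERIV_cmult[OF log_deriv_has_field_derivative[OF assms(1,2,3,5)]])
  then have d: "(z has_field_derivative ?d) (at t)"
    by (rule has_field_derivative_transform_within_open[OF _ assms(1,3)]) (simp add: z)
  then have "(z has_field_derivative ?r) (at t) \<longleftrightarrow> ?d - ?r = 0"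
    using DERIV_unique by force
  also have "?d - ?r = 2 / (t * Z t) * (t * deriv (deriv Z) t + 2 * deriv Z t - Z t)"
    unfolding z[OF assms(3)] log_deriv_def using assms(4,5)
    by (simp add: field_simps power2_eq_square)
  also have "\<dots> = 0 \<longleftrightarrow> ?lin"
    unfolding mult_eq_0_iff divide_eq_0_iff using assms(4,5) by simp
  finally show ?thesis .
qed

lemma riccati_iff_linear:
  assumes "open S" "0 \<notin> S" "Z holomorphic_on S" "\<And>t. t \<in> S \<Longrightarrow> Z t \<noteq> 0"
    and "\<And>t. t \<in> S \<Longrightarrow> z t = 2 * log_deriv Z t"
  shows "solves_riccati S z \<longleftrightarrow> solves_linear S Z"
proof -
  have "(z has_field_derivative (- 1 / 2 * (z t)^2 - 2 / t * z t + 2 / t)) (at t) \<longleftrightarrow>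
      t * deriv (deriv Z) t + 2 * deriv Z t - Z t = 0" if "t \<in> S" for t
    using that assms by (intro riccati_at_iff_linear_at[of S]) auto
  then show ?thesis
    using assms(3) unfolding solves_riccati_def solves_linear_def by auto
qed

definition Z_coeff :: "nat \<Rightarrow> complex" where
  "Z_coeff k = 1 / (pochhammer 2 k * fact k)"

lemma Z_series_term: "1 / pochhammer 2 k * (t ^ k / fact k) = Z_coeff k * t ^ k"
  by (simp add: Z_coeff_def)

lemma Z_series_eq: "Z_series = (\<lambda>t. \<Sum>k. Z_coeff k * t ^ k)"
  by (rule ext) (simp only: Z_series_def Z_series_term)

lemma pochhammer_2_eq_fact: "pochhammer (2::'a::{comm_semiring_1,semiring_char_0}) k = fact (Suc k)"
  by (simp add: pochhammer_fact pochhammer_rec)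

lemma summable_Z_coeff: "summable (\<lambda>k. Z_coeff k * t ^ k)"
proof (rule summable_comparison_test'[OF summable_exp[of "norm t"], of 0])
  fix k
  have "inverse (fact (Suc k)) * inverse (fact k) \<le> 1 * inverse (fact k :: real)"
    by (intro mult_right_mono) (auto simp del: fact_Suc simp: field_simps fact_ge_1)
  then have "norm (Z_coeff k) \<le> inverse (fact k)"
    by (simp add: Z_coeff_def pochhammer_2_eq_fact norm_mult norm_inverse norm_fact divide_inverse
        del: fact_Suc)
  then show "norm (Z_coeff k * t ^ k) \<le> inverse (fact k) * norm t ^ k"
    by (simp add: norm_mult norm_power mult_right_mono)
qed

lemma Z_coeff_recursion: "of_nat (Suc k) * of_nat (k + 2) * Z_coeff (Suc k) = Z_coeff k"
proof -
  have nz: "of_nat (Suc k) \<noteq> (0::complex)" "of_nat (k + 2) \<noteq> (0::complex)"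
    by (simp_all only: of_nat_eq_0_iff)
  have "pochhammer 2 (Suc k) * fact (Suc k)
      = of_nat (Suc k) * of_nat (k + 2) * (pochhammer 2 k * (fact k :: complex))"
    by (simp add: pochhammer_Suc algebra_simps)
  then show ?thesis
    using nz unfolding Z_coeff_def by simp
qed

lemma summable_diffs_Z_coeff: "summable (\<lambda>k. diffs Z_coeff k * t ^ k)"
  by (rule termdiff_converges_all[OF summable_Z_coeff])

lemma deriv_Z_series: "deriv Z_series = (\<lambda>t. \<Sum>k. diffs Z_coeff k * t ^ k)"
  unfolding Z_series_eq fun_eq_iff
  by (intro allI DERIV_imp_deriv termdiffs_strong_converges_everywhere summable_Z_coeff)

lemma deriv_deriv_Z_series: "deriv (deriv Z_series) = (\<lambda>t. \<Sum>k. diffs (diffs Z_coeff) k * t ^ k)"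
  unfolding deriv_Z_series fun_eq_iff
  by (intro allI DERIV_imp_deriv termdiffs_strong_converges_everywhere summable_diffs_Z_coeff)

lemma Z_series_holomorphic: "Z_series holomorphic_on S"
  unfolding Z_series_eq
  by (rule holomorphic_on_subset[of _ UNIV], subst holomorphic_on_open)
     (auto intro: termdiffs_strong_converges_everywhere summable_Z_coeff)

lemma Z_series_ode: "t * deriv (deriv Z_series) t + 2 * deriv Z_series t - Z_series t = 0"
proof -
  let ?c1 = "diffs Z_coeff" and ?c2 = "diffs (diffs Z_coeff)"
  let ?f = "\<lambda>k. of_nat k * ?c1 k * t ^ k"
  have "(\<lambda>k. ?c2 k * t ^ k) sums deriv (deriv Z_series) t"
    unfolding deriv_deriv_Z_series
    by (intro summable_sums termdiff_converges_all summable_diffs_Z_coeff)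
  from sums_mult[OF this, of t] have "(\<lambda>k. ?f (Suc k)) sums (t * deriv (deriv Z_series) t)"
    by (simp add: diffs_def algebra_simps)
  \<comment> \<open>Multiplication by \<open>t\<close> shifts the series by one place; the new term at \<open>0\<close> vanishes.\<close>
  then have "?f sums (t * deriv (deriv Z_series) t)"
    by (subst (asm) sums_Suc_iff) simp
  moreover have "(\<lambda>k. 2 * (?c1 k * t ^ k)) sums (2 * deriv Z_series t)"
    unfolding deriv_Z_series by (intro sums_mult summable_sums summable_diffs_Z_coeff)
  ultimately have "(\<lambda>k. ?f k + 2 * (?c1 k * t ^ k)) sums
      (t * deriv (deriv Z_series) t + 2 * deriv Z_series t)"
    by (rule sums_add)
  moreover have "?f k + 2 * (?c1 k * t ^ k) = Z_coeff k * t ^ k" for k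
    by (subst Z_coeff_recursion[symmetric]) (simp add: diffs_def algebra_simps)
  ultimately have "(\<lambda>k. Z_coeff k * t ^ k) sums
      (t * deriv (deriv Z_series) t + 2 * deriv Z_series t)"
    by simp
  then show ?thesis
    by (simp add: Z_series_eq sums_unique[symmetric])
qed

lemma Z_series_linear: "solves_linear S Z_series"
  using Z_series_holomorphic Z_series_ode by (simp add: solves_linear_def)

lemma Z_series_0: "Z_series 0 = 1"
  unfolding Z_series_eq powser_zero by (simp add: Z_coeff_def)

lemma Z_series_nonzero_exists: "\<exists>t. t \<noteq> 0 \<and> Z_series t \<noteq> 0"
proof -
  have "isCont Z_series 0"
    using holomorphic_on_imp_continuous_on[OF Z_series_holomorphic[of UNIV]]
    by (simp add: continuous_on_eq_continuous_at)
  then have "\<forall>\<^sub>F t in at 0. Z_series t \<noteq> 0"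
    unfolding isCont_def by (rule tendsto_imp_eventually_ne) (simp add: Z_series_0)
  then have "\<forall>\<^sub>F t in at 0. t \<noteq> 0 \<and> Z_series t \<noteq> 0"
    using eventually_neq_at_within by (rule eventually_conj[rotated])
  then show ?thesis
    by (rule eventually_happens'[rotated]) simp
qed

lemma open_Z_series_nonzero: "open {t. t \<noteq> 0 \<and> Z_series t \<noteq> 0}"
  by (intro open_Collect_conj open_Collect_neq continuous_intros
      holomorphic_on_imp_continuous_on Z_series_holomorphic)

theorem mainTheorem7:
  shows
    "(\<forall>(S :: complex set) (z :: complex \<Rightarrow> complex).
        open S \<longrightarrow> 0 \<notin> S \<longrightarrow>
        (solves_system 0 (3/2) S (\<lambda>_. 0) (\<lambda>_. 0) z \<longleftrightarrow> solves_riccati S z))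
     \<and>
     (\<forall>(S :: complex set) (z :: complex \<Rightarrow> complex) (Z :: complex \<Rightarrow> complex).
        open S \<longrightarrow> 0 \<notin> S \<longrightarrow>
        Z holomorphic_on S \<longrightarrow> (\<forall>t\<in>S. Z t \<noteq> 0) \<longrightarrow>
        (\<forall>t\<in>S. z t = 2 * log_deriv Z t) \<longrightarrow>
        (solves_riccati S z \<longleftrightarrow> solves_linear S Z))
     \<and>
     (\<forall>t :: complex. summable (\<lambda>k. 1 / pochhammer 2 k * (t ^ k / fact k)))
     \<and>
     solves_linear UNIV Z_series
     \<and>
     {t. t \<noteq> 0 \<and> Z_series t \<noteq> 0} \<noteq> {}
     \<and>
     solves_system 0 (3/2) {t. t \<noteq> 0 \<and> Z_series t \<noteq> 0}
       (\<lambda>_. 0) (\<lambda>_. 0) (\<lambda>t. 2 * log_deriv Z_series t)"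
proof (intro conjI)
  let ?S = "{t. t \<noteq> 0 \<and> Z_series t \<noteq> 0}"
  show "\<forall>S z. open S \<longrightarrow> 0 \<notin> S \<longrightarrow>
      (solves_system 0 (3/2) S (\<lambda>_. 0) (\<lambda>_. 0) z \<longleftrightarrow> solves_riccati S z)"
    by (simp add: system_zero_iff_riccati)
  show "\<forall>S z Z. open S \<longrightarrow> 0 \<notin> S \<longrightarrow> Z holomorphic_on S \<longrightarrow> (\<forall>t\<in>S. Z t \<noteq> 0) \<longrightarrow>
      (\<forall>t\<in>S. z t = 2 * log_deriv Z t) \<longrightarrow> (solves_riccati S z \<longleftrightarrow> solves_linear S Z)"
    using riccati_iff_linear by blast
  show "\<forall>t :: complex. summable (\<lambda>k. 1 / pochhammer 2 k * (t ^ k / fact k))"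
    unfolding Z_series_term using summable_Z_coeff by blast
  show "solves_linear UNIV Z_series"
    by (rule Z_series_linear)
  show "?S \<noteq> {}"
    using Z_series_nonzero_exists by blast
  have "solves_riccati ?S (\<lambda>t. 2 * log_deriv Z_series t) \<longleftrightarrow> solves_linear ?S Z_series"
    by (rule riccati_iff_linear[OF open_Z_series_nonzero]) (auto intro: Z_series_holomorphic)
  then show "solves_system 0 (3/2) ?S (\<lambda>_. 0) (\<lambda>_. 0) (\<lambda>t. 2 * log_deriv Z_series t)"
    using Z_series_linear by (simp add: system_zero_iff_riccati)
qed

end
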